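(* Let $n\ge 1$ and let $\bar A=(a_{i,j})_{1\le i<j\le 2n}$ be the triangular array with $a_{i,j}=(x_i-x_j)^2$, where $x_1,\ldots,x_{2n}$ are indeterminates over a field of characteristic different from $2$. Then $$pf_{2n}\bar A=-(-2)^{n-1}(x_1-x_2)(x_2-x_3)\cdots(x_{2n-1}-x_{2n})(x_{2n}-x_1).$$
   Context: For a triangular array $\bar A=(a_{i,j})_{1\le i<j\le 2n}$ its Pfaffian is $pf_{2n}\bar A=\sum_{\pi}\operatorname{sign}(\pi)\,a_{i_1,j_1}\cdots a_{i_n,j_n}$, the sum over all permutations $\pi\in S_{2n}$ with one-line notation $(i_1,j_1,\ldots,i_n,j_n)$ satisfying $i_1<i_2<\cdots<i_n$ and $i_s<j_s$ for all $s$; $\operatorname{sign}(\pi)$ is the sign of the permutation. *)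

theory Defs
  imports "HOL-Library.Poly_Mapping" "HOL-Combinatorics.Permutations"
begin

text \<open>
  The one-line notation of \<open>\<pi>\<close> is \<open>(i\<^sub>1, j\<^sub>1, \<dots>, i\<^sub>n, j\<^sub>n)\<close>, that is,
  \<open>i\<^sub>s = \<pi> (2 * s - 1)\<close> and \<open>j\<^sub>s = \<pi> (2 * s)\<close> for \<open>1 \<le> s \<le> n\<close>.
\<close>

definition pfaffian_perms :: "nat \<Rightarrow> (nat \<Rightarrow> nat) set" where
  "pfaffian_perms n = {\<pi>. \<pi> permutes {1..2 * n} \<and>
     strict_mono_on {1..n} (\<lambda>s. \<pi> (2 * s - 1)) \<and>
     (\<forall>s\<in>{1..n}. \<pi> (2 * s - 1) < \<pi> (2 * s))}"

text \<open>
  The argument \<open>n\<close> is half the size: \<open>pfaffian n A\<close> is the Pfaffian of the triangular array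
  \<open>(A i j)\<close> with \<open>1 \<le> i < j \<le> 2 * n\<close>. All other values of \<open>A\<close> are irrelevant.
\<close>

definition pfaffian :: "nat \<Rightarrow> (nat \<Rightarrow> nat \<Rightarrow> 'r) \<Rightarrow> 'r::comm_ring_1" where
  "pfaffian n A = (\<Sum>\<pi>\<in>pfaffian_perms n.
     of_int (sign \<pi>) * (\<Prod>s = 1..n. A (\<pi> (2 * s - 1)) (\<pi> (2 * s))))"

text \<open>
  A polynomial maps each monomial, given as an exponent vector of finite support, to its
  coefficient. The indeterminates are indexed by all of \<open>nat\<close>.
\<close>

type_synonym 'a mpoly = "(nat \<Rightarrow>\<^sub>0 nat) \<Rightarrow>\<^sub>0 'a"

definition indet :: "nat \<Rightarrow> 'a::comm_ring_1 mpoly" where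
  "indet i = Poly_Mapping.single (Poly_Mapping.single i 1) 1"

end

theory Submission
  imports Defs
begin

text \<open>
  Expand the Pfaffian along the first row and argue by induction on \<open>n\<close>, over any commutative
  ring. With \<open>d\<^sub>i = x\<^sub>i - x\<^sub>i\<^sub>+\<^sub>1\<close> and \<open>Q\<^sub>j\<close> the product of all \<open>d\<^sub>i\<close>, \<open>2 \<le> i \<le> 2n + 1\<close>, \<open>i \<noteq> j\<close>,
  the path product along \<open>x\<^sub>2, \<dots>, x\<^sub>2\<^sub>n\<^sub>+\<^sub>2\<close> with an interior point \<open>x\<^sub>j\<close> left out is
  \<open>Q\<^sub>j + Q\<^sub>j\<^sub>-\<^sub>1\<close>, because \<open>x\<^sub>j\<^sub>-\<^sub>1 - x\<^sub>j\<^sub>+\<^sub>1 = d\<^sub>j\<^sub>-\<^sub>1 + d\<^sub>j\<close>. Summation by parts then pairs \<open>Q\<^sub>j\<close> with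
  \<open>(x\<^sub>1 - x\<^sub>j)\<^sup>2 - (x\<^sub>1 - x\<^sub>j\<^sub>+\<^sub>1)\<^sup>2\<close>, a multiple of \<open>d\<^sub>j\<close>, and the alternating sum that remains
  telescopes. With \<open>u = x\<^sub>1 - x\<^sub>2\<close> and \<open>v = x\<^sub>2\<^sub>n\<^sub>+\<^sub>2 - x\<^sub>1\<close> the row expansion is a multiple of
  \<open>u\<^sup>2 + v\<^sup>2 - (u + v)\<^sup>2 = -2uv\<close>.
\<close>

section \<open>Expansion of the Pfaffian along the first row\<close>

text \<open>For \<open>j \<ge> 2\<close>, the cycle 2 -> j -> j-1 -> ... -> 3 -> 2: it puts the
  value \<open>j\<close> in place 2 and keeps the order of the other values.\<close>

definition row_cycle :: "nat \<Rightarrow> nat \<Rightarrow> nat" where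
  "row_cycle j u = (if u = 2 then j else if 3 \<le> u \<and> u \<le> j then u - 1 else u)"

text \<open>On \<open>t \<ge> 1\<close> this is the increasing enumeration of the indices other than \<open>1\<close> and \<open>j\<close>.\<close>

definition skip :: "nat \<Rightarrow> nat \<Rightarrow> nat" where
  "skip j t = (if t + 2 \<le> j then t + 1 else t + 2)"

lemma row_cycle_add_2: "t \<ge> 1 \<Longrightarrow> row_cycle j (t + 2) = skip j t"
  by (auto simp: row_cycle_def skip_def)

lemma skip_less_iff: "skip j s < skip j t \<longleftrightarrow> s < t"
  by (auto simp: skip_def)

lemma row_cycle_2: "row_cycle 2 = id"
  by (auto simp: row_cycle_def fun_eq_iff)

text \<open>One adjacent transposition per step, so that the permutation property and the sign
  \<open>(- 1) ^ j\<close> both follow by induction from \<open>j = 2\<close>.\<close>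

lemma row_cycle_Suc:
  assumes "j \<ge> 2"
  shows "row_cycle (Suc j) = transpose j (Suc j) \<circ> row_cycle j"
  using assms by (auto simp: row_cycle_def fun_eq_iff transpose_def)

lemma row_cycle_permutes:
  assumes "2 \<le> j" "j \<le> N"
  shows "row_cycle j permutes {1..N}"
  using assms
proof (induction j rule: dec_induct)
  case base
  then show ?case by (simp only: row_cycle_2 permutes_id)
next
  case (step j)
  then show ?case
    unfolding row_cycle_Suc[OF step(1)] by (intro permutes_compose permutes_swap_id) auto
qed

lemma sign_row_cycle:
  assumes "2 \<le> j"
  shows "sign (row_cycle j) = (- 1) ^ j"
  using assms
proof (induction j rule: dec_induct)
  case base
  then show ?case by (simp add: row_cycle_2)
next
  case (step j)
  have "permutation (row_cycle j)"
    using row_cycle_permutes[OF step(1) order_refl] by (auto simp: permutation_permutes)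
  then have "sign (row_cycle (Suc j)) = sign (transpose j (Suc j)) * sign (row_cycle j)"
    unfolding row_cycle_Suc[OF step(1)] by (intro sign_compose permutation_swap_id)
  then show ?case
    using step by (simp add: sign_swap_id)
qed

section \<open>Inserting and removing the pair that contains 1\<close>

text \<open>For \<open>\<sigma>\<close> permuting \<open>{1..2 * n}\<close> and
  \<open>2 \<le> j\<close>, the one-line notation is \<open>1\<close>, \<open>j\<close>, then the
  entries of \<open>\<sigma>\<close> relabelled by \<open>skip j\<close>. As a composition it has a
  multiplicative sign.\<close>

definition insert_pair :: "nat \<Rightarrow> nat \<Rightarrow> (nat \<Rightarrow> nat) \<Rightarrow> nat \<Rightarrow> nat" where
  "insert_pair n j \<sigma> = row_cycle j \<circ> map_permutation {1..2 * n} (\<lambda>t. t + 2) \<sigma>"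

definition remove_pair :: "nat \<Rightarrow> (nat \<Rightarrow> nat) \<Rightarrow> nat \<Rightarrow> nat" where
  "remove_pair n \<pi> = map_permutation {3..2 * n + 2} (\<lambda>t. t - 2) (inv (row_cycle (\<pi> 2)) \<circ> \<pi>)"

lemma bij_betw_add_2: "bij_betw (\<lambda>t::nat. t + 2) {1..2 * n} {3..2 * n + 2}"
  by (rule bij_betw_byWitness[where f' = "\<lambda>t. t - 2"]) auto

lemma bij_betw_diff_2: "bij_betw (\<lambda>t::nat. t - 2) {3..2 * n + 2} {1..2 * n}"
  by (rule bij_betw_byWitness[where f' = "\<lambda>t. t + 2"]) auto

context
  fixes n j :: nat and \<sigma> :: "nat \<Rightarrow> nat"
  assumes perm: "\<sigma> permutes {1..2 * n}" and j: "2 \<le> j" "j \<le> 2 * n + 2"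
begin

lemma shift_permutes: "map_permutation {1..2 * n} (\<lambda>t. t + 2) \<sigma> permutes {3..2 * n + 2}"
  by (rule map_permutation_permutes[OF bij_betw_add_2 perm])

lemma insert_pair_permutes: "insert_pair n j \<sigma> permutes {1..2 * Suc n}"
  unfolding insert_pair_def
  by (intro permutes_compose row_cycle_permutes permutes_subset[OF shift_permutes])
    (use j in auto)

lemma sign_insert_pair: "sign (insert_pair n j \<sigma>) = (- 1) ^ j * sign \<sigma>"
proof -
  have "permutation (row_cycle j)"
    using row_cycle_permutes[OF j] by (auto simp: permutation_permutes)
  moreover have "permutation (map_permutation {1..2 * n} (\<lambda>t. t + 2) \<sigma>)"
    using shift_permutes by (auto simp: permutation_permutes)
  moreover have "sign (map_permutation {1..2 * n} (\<lambda>t. t + 2) \<sigma>) = sign \<sigma>"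
    by (intro sign_map_permutation perm inj_onI) auto
  ultimately show ?thesis
    unfolding insert_pair_def using sign_row_cycle[OF j(1)] by (metis sign_compose)
qed

lemma insert_pair_1: "insert_pair n j \<sigma> 1 = 1"
  using permutes_not_in[OF shift_permutes, of 1] by (simp add: insert_pair_def row_cycle_def)

lemma insert_pair_2: "insert_pair n j \<sigma> 2 = j"
  using permutes_not_in[OF shift_permutes, of 2] by (simp add: insert_pair_def row_cycle_def)

lemma insert_pair_add_2:
  assumes "t \<in> {1..2 * n}"
  shows "insert_pair n j \<sigma> (t + 2) = skip j (\<sigma> t)"
proof -
  have "map_permutation {1..2 * n} (\<lambda>t. t + 2) \<sigma> (t + 2) = \<sigma> t + 2"
    by (intro map_permutation_apply[where f = "\<lambda>t. t + 2"] inj_onI perm assms) auto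
  moreover have "\<sigma> t \<ge> 1"
    using permutes_in_image[OF perm, of t] assms by auto
  ultimately show ?thesis
    unfolding insert_pair_def comp_def by (simp only: row_cycle_add_2)
qed

lemma insert_pair_odd:
  assumes "s \<in> {1..n}"
  shows "insert_pair n j \<sigma> (2 * Suc s - 1) = skip j (\<sigma> (2 * s - 1))"
proof -
  have "2 * Suc s - 1 = (2 * s - 1) + 2" "2 * s - 1 \<in> {1..2 * n}"
    using assms by auto
  then show ?thesis
    by (simp only: insert_pair_add_2)
qed

lemma insert_pair_even:
  assumes "s \<in> {1..n}"
  shows "insert_pair n j \<sigma> (2 * Suc s) = skip j (\<sigma> (2 * s))"
proof -
  have "2 * Suc s = 2 * s + 2" "2 * s \<in> {1..2 * n}"
    using assms by auto
  then show ?thesis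
    by (simp only: insert_pair_add_2)
qed

text \<open>Since \<open>skip j\<close> is strictly increasing, the order conditions on the later
  pairs are those of \<open>\<sigma>\<close>. The new first pair adds no constraint:
  \<open>1\<close> is below \<open>j\<close> and below every \<open>skip j t\<close> with
  \<open>t \<ge> 1\<close>.\<close>

lemma insert_pair_in_pfaffian_perms_iff:
  "insert_pair n j \<sigma> \<in> pfaffian_perms (Suc n) \<longleftrightarrow> \<sigma> \<in> pfaffian_perms n"
proof -
  let ?\<pi> = "insert_pair n j \<sigma>"
  have range: "{1..Suc n} = insert 1 (Suc ` {1..n})"
    by (auto simp: image_Suc_atLeastAtMost)
  \<comment> \<open>\<open>2 * 1\<close> stays unevaluated to match the instance
    \<open>s = 1\<close> of the order conditions.\<close>
  have one: "?\<pi> (2 * 1 - 1) = 1" "?\<pi> (2 * 1) = j"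
    using insert_pair_1 insert_pair_2 by simp_all
  have gt1: "1 < skip j (\<sigma> (2 * s - 1))" if "s \<in> {1..n}" for s
    using permutes_in_image[OF perm, of "2 * s - 1"] that by (auto simp: skip_def)
  have "(\<forall>s\<in>{1..Suc n}. ?\<pi> (2 * s - 1) < ?\<pi> (2 * s)) \<longleftrightarrow>
      (\<forall>s\<in>{1..n}. \<sigma> (2 * s - 1) < \<sigma> (2 * s))"
  proof -
    have "?\<pi> (2 * 1 - 1) < ?\<pi> (2 * 1)"
      using one j by simp
    moreover have "?\<pi> (2 * Suc s - 1) < ?\<pi> (2 * Suc s) \<longleftrightarrow> \<sigma> (2 * s - 1) < \<sigma> (2 * s)"
      if "s \<in> {1..n}" for s
      unfolding insert_pair_odd[OF that] insert_pair_even[OF that] skip_less_iff ..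
    ultimately show ?thesis
      unfolding range by (simp only: ball_simps image_iff) blast
  qed
  moreover have "strict_mono_on {1..Suc n} (\<lambda>s. ?\<pi> (2 * s - 1)) \<longleftrightarrow>
      strict_mono_on {1..n} (\<lambda>s. \<sigma> (2 * s - 1))"
  proof
    assume *: "strict_mono_on {1..Suc n} (\<lambda>s. ?\<pi> (2 * s - 1))"
    show "strict_mono_on {1..n} (\<lambda>s. \<sigma> (2 * s - 1))"
    proof (rule strict_mono_onI)
      fix r s assume rs: "r \<in> {1..n}" "s \<in> {1..n}" "r < s"
      then have "?\<pi> (2 * Suc r - 1) < ?\<pi> (2 * Suc s - 1)"
        using strict_mono_onD[OF *, of "Suc r" "Suc s"] by auto
      then show "\<sigma> (2 * r - 1) < \<sigma> (2 * s - 1)"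
        unfolding insert_pair_odd[OF rs(1)] insert_pair_odd[OF rs(2)] skip_less_iff .
    qed
  next
    assume *: "strict_mono_on {1..n} (\<lambda>s. \<sigma> (2 * s - 1))"
    show "strict_mono_on {1..Suc n} (\<lambda>s. ?\<pi> (2 * s - 1))"
    proof (rule strict_mono_onI)
      fix r s assume rs: "r \<in> {1..Suc n}" "s \<in> {1..Suc n}" "r < s"
      then obtain s' where s': "s = Suc s'" "s' \<in> {1..n}" by (cases s) auto
      show "?\<pi> (2 * r - 1) < ?\<pi> (2 * s - 1)"
      proof (cases "r = 1")
        case True
        show ?thesis
          unfolding True s'(1) insert_pair_odd[OF s'(2)] one using gt1[OF s'(2)] .
      next
        case False
        then obtain r' where r': "r = Suc r'" "r' \<in> {1..n}" using rs by (cases r) auto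
        have "\<sigma> (2 * r' - 1) < \<sigma> (2 * s' - 1)"
          using strict_mono_onD[OF *, of r' s'] r' s' rs by auto
        then show ?thesis
          unfolding r'(1) s'(1) insert_pair_odd[OF s'(2)] insert_pair_odd[OF r'(2)] skip_less_iff .
      qed
    qed
  qed
  ultimately show ?thesis
    unfolding pfaffian_perms_def using perm insert_pair_permutes by simp
qed

lemma remove_insert_pair: "remove_pair n (insert_pair n j \<sigma>) = \<sigma>"
proof -
  have "inv (row_cycle j) \<circ> insert_pair n j \<sigma> = map_permutation {1..2 * n} (\<lambda>t. t + 2) \<sigma>"
    unfolding insert_pair_def comp_assoc[symmetric]
    using permutes_inv_o(2)[OF row_cycle_permutes[OF j]] by simp
  then show ?thesis
    unfolding remove_pair_def insert_pair_2
    using map_permutation_compose_inv[OF bij_betw_add_2 perm, where g = "\<lambda>t. t - 2"] by simp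
qed

end

text \<open>All entries are positive. If \<open>1\<close> stood in an even place, its left partner
  would be smaller; in an odd place after the first, the first entry would be smaller.\<close>

lemma pfaffian_perms_1:
  assumes "\<pi> \<in> pfaffian_perms (Suc n)"
  shows "\<pi> 1 = 1"
proof -
  have perm: "\<pi> permutes {1..2 * Suc n}"
    and mono: "strict_mono_on {1..Suc n} (\<lambda>s. \<pi> (2 * s - 1))"
    and less: "\<And>s. s \<in> {1..Suc n} \<Longrightarrow> \<pi> (2 * s - 1) < \<pi> (2 * s)"
    using assms by (auto simp: pfaffian_perms_def)
  have pos: "\<pi> t \<ge> 1" if "t \<in> {1..2 * Suc n}" for t
    using permutes_in_image[OF perm, of t] that by simp
  have "1 \<in> \<pi> ` {1..2 * Suc n}"
    using permutes_image[OF perm] by simp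
  then obtain u where u: "u \<in> {1..2 * Suc n}" "\<pi> u = 1"
    by auto
  show ?thesis
  proof (cases "even u")
    case True
    then obtain s where s: "u = 2 * s" by blast
    then have "\<pi> (2 * s - 1) < 1"
      using less[of s] u by auto
    then show ?thesis
      using pos[of "2 * s - 1"] u s by force
  next
    case False
    then obtain s where s: "u = 2 * s + 1" using oddE by blast
    show ?thesis
    proof (cases "s = 0")
      case True
      then show ?thesis using s u by simp
    next
      case False
      then have "\<pi> 1 < 1"
        using strict_mono_onD[OF mono, of 1 "Suc s"] s u by auto
      then show ?thesis using pos[of 1] by simp
    qed
  qed
qed

lemma
  assumes "\<pi> \<in> pfaffian_perms (Suc n)"
  shows pfaffian_perms_2_bounds: "2 \<le> \<pi> 2" "\<pi> 2 \<le> 2 * n + 2"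
    and remove_pair_permutes: "remove_pair n \<pi> permutes {1..2 * n}"
    and insert_remove_pair: "insert_pair n (\<pi> 2) (remove_pair n \<pi>) = \<pi>"
proof -
  have perm: "\<pi> permutes {1..2 * n + 2}"
    using assms by (simp add: pfaffian_perms_def)
  have one: "\<pi> 1 = 1"
    using pfaffian_perms_1[OF assms] .
  have "\<pi> 2 \<noteq> 1"
    using permutes_inj[OF perm] one by (metis inj_eq numeral_eq_one_iff semiring_norm(85))
  then show j: "2 \<le> \<pi> 2" "\<pi> 2 \<le> 2 * n + 2"
    using permutes_in_image[OF perm, of 2] by auto
  let ?c = "row_cycle (\<pi> 2)"
  let ?\<tau> = "inv ?c \<circ> \<pi>"
  have c: "?c permutes {1..2 * n + 2}"
    using row_cycle_permutes[OF j] .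
  have \<tau>: "?\<tau> permutes {3..2 * n + 2}"
  proof (rule permutes_superset)
    show "?\<tau> permutes {1..2 * n + 2}"
      by (intro permutes_compose permutes_inv perm c)
    \<comment> \<open>\<open>\<pi>\<close> and the cycle agree at \<open>1\<close> and
      \<open>2\<close>, so \<open>?\<tau>\<close> fixes both points.\<close>
    have "?c 1 = 1" "?c 2 = \<pi> 2"
      by (simp_all add: row_cycle_def)
    then have "?\<tau> 1 = 1" "?\<tau> 2 = 2"
      using permutes_inverses(2)[OF c] one by (metis comp_apply)+
    moreover have "{1..2 * n + 2} - {3..2 * n + 2} = {1, 2::nat}"
      by auto
    ultimately show "\<And>t. t \<in> {1..2 * n + 2} - {3..2 * n + 2} \<Longrightarrow> ?\<tau> t = t"
      by (metis insertE singletonD)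
  qed
  show "remove_pair n \<pi> permutes {1..2 * n}"
    unfolding remove_pair_def by (rule map_permutation_permutes[OF bij_betw_diff_2 \<tau>])
  have "map_permutation {1..2 * n} (\<lambda>t. t + 2) (remove_pair n \<pi>) = ?\<tau>"
    unfolding remove_pair_def
    by (rule map_permutation_compose_inv[OF bij_betw_diff_2 \<tau>]) auto
  then show "insert_pair n (\<pi> 2) (remove_pair n \<pi>) = \<pi>"
    unfolding insert_pair_def using permutes_inv_o(1)[OF c] by (simp flip: comp_assoc)
qed

text \<open>Such a permutation amounts to the partner \<open>j\<close> of \<open>1\<close> together
  with a Pfaffian permutation of the other indices, renumbered by \<open>skip j\<close>; the sign
  \<open>(- 1) ^ j\<close> is that of the row cycle.\<close>

theorem pfaffian_Suc:
  "pfaffian (Suc n) A =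
    (\<Sum>j = 2..2 * n + 2. (- 1) ^ j * A 1 j * pfaffian n (\<lambda>p q. A (skip j p) (skip j q)))"
proof -
  let ?g = "\<lambda>n A \<pi>. of_int (sign \<pi>) * (\<Prod>s = 1..n. A (\<pi> (2 * s - 1)) (\<pi> (2 * s)))"
  let ?h = "\<lambda>(j, \<sigma>). (- 1) ^ j * A 1 j * ?g n (\<lambda>p q. A (skip j p) (skip j q)) \<sigma>"
  have term_eq: "?h (j, \<sigma>) = ?g (Suc n) A (insert_pair n j \<sigma>)"
    if "\<sigma> permutes {1..2 * n}" "2 \<le> j" "j \<le> 2 * n + 2" for j \<sigma>
  proof -
    let ?\<pi> = "insert_pair n j \<sigma>"
    have "(\<Prod>s = 1..Suc n. A (?\<pi> (2 * s - 1)) (?\<pi> (2 * s))) =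
        A (?\<pi> (2 * 1 - 1)) (?\<pi> (2 * 1)) * (\<Prod>s = 1..n. A (?\<pi> (2 * Suc s - 1)) (?\<pi> (2 * Suc s)))"
      by (subst prod.atLeast_Suc_atMost, simp) (simp only: prod.shift_bounds_cl_Suc_ivl)
    also have "A (?\<pi> (2 * 1 - 1)) (?\<pi> (2 * 1)) = A 1 j"
      using insert_pair_1[OF that] insert_pair_2[OF that] by simp
    also have "(\<Prod>s = 1..n. A (?\<pi> (2 * Suc s - 1)) (?\<pi> (2 * Suc s))) =
        (\<Prod>s = 1..n. A (skip j (\<sigma> (2 * s - 1))) (skip j (\<sigma> (2 * s))))"
      by (intro prod.cong refl) (simp only: insert_pair_odd[OF that] insert_pair_even[OF that])
    finally show ?thesis
      by (simp only: prod.case sign_insert_pair[OF that] of_int_mult of_int_power of_int_minus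
          of_int_1 mult_ac)
  qed
  have "pfaffian (Suc n) A = sum (?g (Suc n) A) (pfaffian_perms (Suc n))"
    by (simp add: pfaffian_def)
  also have "\<dots> = sum ?h ({2..2 * n + 2} \<times> pfaffian_perms n)"
  proof (rule sum.reindex_bij_witness[where i = "\<lambda>(j, \<sigma>). insert_pair n j \<sigma>"
        and j = "\<lambda>\<pi>. (\<pi> 2, remove_pair n \<pi>)"])
    fix \<pi> assume \<pi>: "\<pi> \<in> pfaffian_perms (Suc n)"
    note facts = remove_pair_permutes[OF \<pi>] pfaffian_perms_2_bounds[OF \<pi>]
    show "(case (\<pi> 2, remove_pair n \<pi>) of (j, \<sigma>) \<Rightarrow> insert_pair n j \<sigma>) = \<pi>"
      using insert_remove_pair[OF \<pi>] by simp
    show "(\<pi> 2, remove_pair n \<pi>) \<in> {2..2 * n + 2} \<times> pfaffian_perms n"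
      \<comment> \<open>Reinserting the removed pair gives back \<open>\<pi>\<close>, so the
        equivalence yields membership of \<open>remove_pair n \<pi>\<close>.\<close>
      using facts insert_pair_in_pfaffian_perms_iff[OF facts] \<pi> insert_remove_pair[OF \<pi>] by simp
    show "?h (\<pi> 2, remove_pair n \<pi>) = ?g (Suc n) A \<pi>"
      using term_eq[OF facts] unfolding insert_remove_pair[OF \<pi>] .
  next
    fix b assume "b \<in> {2..2 * n + 2} \<times> pfaffian_perms n"
    then obtain j \<sigma> where b: "b = (j, \<sigma>)" "2 \<le> j" "j \<le> 2 * n + 2" "\<sigma> \<in> pfaffian_perms n"
      by auto
    then have facts: "\<sigma> permutes {1..2 * n}" "2 \<le> j" "j \<le> 2 * n + 2"
      by (auto simp: pfaffian_perms_def)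
    let ?\<pi> = "case b of (j, \<sigma>) \<Rightarrow> insert_pair n j \<sigma>"
    show "(?\<pi> 2, remove_pair n ?\<pi>) = b"
      using b(1) insert_pair_2[OF facts] remove_insert_pair[OF facts] by simp
    show "?\<pi> \<in> pfaffian_perms (Suc n)"
      using b insert_pair_in_pfaffian_perms_iff[OF facts] by simp
  qed
  also have "\<dots> = (\<Sum>j = 2..2 * n + 2. \<Sum>\<sigma>\<in>pfaffian_perms n. ?h (j, \<sigma>))"
    by (simp add: sum.cartesian_product)
  finally show ?thesis
    by (simp add: pfaffian_def sum_distrib_left)
qed

lemma pfaffian_0: "pfaffian 0 A = 1"
proof -
  have "pfaffian_perms 0 = {id}"
    by (auto simp: pfaffian_perms_def strict_mono_on_def)
  then show ?thesis
    by (simp add: pfaffian_def)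
qed

section \<open>The cyclic product\<close>

definition cyclic_prod :: "nat \<Rightarrow> (nat \<Rightarrow> 'r) \<Rightarrow> 'r::comm_ring_1" where
  "cyclic_prod m x = (\<Prod>i = 1..m - 1. x i - x (i + 1)) * (x m - x 1)"

text \<open>For \<open>m = 2 * n + 1\<close> this is \<open>Q\<^sub>j\<close>. Omitting the factor,
  rather than dividing by it, makes sense over any commutative ring.\<close>

definition gap_prod :: "(nat \<Rightarrow> 'r) \<Rightarrow> nat \<Rightarrow> nat \<Rightarrow> 'r::comm_ring_1" where
  "gap_prod x m j = (\<Prod>i\<in>{2..m} - {j}. x i - x (i + 1))"

lemma gap_prod_remove:
  assumes "2 \<le> j" "j \<le> m"
  shows "(\<Prod>i = 2..m. x i - x (i + 1)) = (x j - x (j + 1)) * gap_prod x m j"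
  unfolding gap_prod_def using assms by (intro prod.remove) auto

section \<open>Path products with one point left out\<close>

text \<open>The omitted point is an end of the path from \<open>x 2\<close> to
  \<open>x (m + 3)\<close>, so just one factor disappears; the next lemma treats the other
  end.\<close>

lemma path_prod_skip_first:
  fixes x :: "nat \<Rightarrow> 'r::comm_ring_1"
  shows "(\<Prod>i = 1..m. x (skip 2 i) - x (skip 2 (i + 1))) = gap_prod x (m + 2) 2"
  unfolding gap_prod_def
  by (rule prod.reindex_bij_witness[where i = "\<lambda>i. i - 2" and j = "\<lambda>i. i + 2"])
    (auto simp: skip_def)

lemma path_prod_skip_last:
  fixes x :: "nat \<Rightarrow> 'r::comm_ring_1"
  shows "(\<Prod>i = 1..m. x (skip (m + 3) i) - x (skip (m + 3) (i + 1))) = gap_prod x (m + 2) (m + 2)"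
  unfolding gap_prod_def
  by (rule prod.reindex_bij_witness[where i = "\<lambda>i. i - 1" and j = "\<lambda>i. i + 1"])
    (auto simp: skip_def)

lemma path_prod_skip_interior:
  fixes x :: "nat \<Rightarrow> 'r::comm_ring_1"
  assumes "3 \<le> j" "j \<le> m + 2"
  shows "(\<Prod>i = 1..m. x (skip j i) - x (skip j (i + 1))) =
    gap_prod x (m + 2) j + gap_prod x (m + 2) (j - 1)"
proof -
  \<comment> \<open>\<open>R\<close> lacks both factors containing \<open>x j\<close>. Each of the
    two gap products is \<open>R\<close> times one of them, and the path without \<open>x j\<close>
    is \<open>R\<close> times their sum.\<close>
  define R where "R = (\<Prod>i\<in>{2..m + 2} - {j - 1, j}. x i - x (i + 1))"
  have "gap_prod x (m + 2) j = (x (j - 1) - x j) * (\<Prod>i\<in>{2..m + 2} - {j} - {j - 1}. x i - x (i + 1))"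
    unfolding gap_prod_def using assms by (subst prod.remove[of _ "j - 1"]) auto
  also have "{2..m + 2} - {j} - {j - 1} = {2..m + 2} - {j - 1, j}"
    by auto
  finally have Q1: "gap_prod x (m + 2) j = (x (j - 1) - x j) * R"
    unfolding R_def .
  have "gap_prod x (m + 2) (j - 1) =
      (x j - x (j + 1)) * (\<Prod>i\<in>{2..m + 2} - {j - 1} - {j}. x i - x (i + 1))"
    unfolding gap_prod_def using assms by (subst prod.remove[of _ j]) auto
  also have "{2..m + 2} - {j - 1} - {j} = {2..m + 2} - {j - 1, j}"
    by auto
  finally have Q2: "gap_prod x (m + 2) (j - 1) = (x j - x (j + 1)) * R"
    unfolding R_def .
  \<comment> \<open>At position \<open>j - 2\<close> the enumeration \<open>skip j\<close> jumps
    from \<open>j - 1\<close> to \<open>j + 1\<close>.\<close>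
  have "(\<Prod>i = 1..m. x (skip j i) - x (skip j (i + 1))) =
      (x (skip j (j - 2)) - x (skip j (j - 2 + 1))) *
      (\<Prod>i\<in>{1..m} - {j - 2}. x (skip j i) - x (skip j (i + 1)))"
    using assms by (intro prod.remove) auto
  also have "(\<Prod>i\<in>{1..m} - {j - 2}. x (skip j i) - x (skip j (i + 1))) = R"
    unfolding R_def
    by (rule prod.reindex_bij_witness[where i = "\<lambda>i. if i < j then i - 1 else i - 2" and j = "skip j"])
      (use assms in \<open>auto simp: skip_def\<close>)
  also have "x (skip j (j - 2)) - x (skip j (j - 2 + 1)) = (x (j - 1) - x j) + (x j - x (j + 1))"
  proof -
    have "skip j (j - 2) = j - 1" "skip j (j - 2 + 1) = j + 1"
      using assms by (auto simp: skip_def)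
    then show ?thesis by simp
  qed
  finally show ?thesis
    unfolding Q1 Q2 by (simp only: distrib_right)
qed

section \<open>Two alternating sums\<close>

text \<open>Each \<open>q j\<close> occurs twice, with \<open>f j\<close> and, under the opposite
  sign, with \<open>f (j + 1)\<close>. The end terms stand apart because they carry a single
  \<open>q\<close>.\<close>

lemma alternating_sum_by_parts:
  fixes f q :: "nat \<Rightarrow> 'r::comm_ring_1"
  assumes "2 \<le> m"
  shows "f 2 * q 2 + (\<Sum>j = 3..m. (- 1) ^ j * f j * (q j + q (j - 1))) + (- 1) ^ (m + 1) * f (m + 1) * q m =
    (\<Sum>j = 2..m. (- 1) ^ j * (q j * (f j - f (j + 1))))"
  using assms
proof (induction m rule: dec_induct)
  case base
  then show ?case by (simp add: algebra_simps)
next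
  case (step m)
  then show ?case
    by (simp add: step.IH[symmetric]) (simp add: algebra_simps)
qed

lemma alternating_telescope:
  fixes c :: "nat \<Rightarrow> 'r::comm_ring_1"
  shows "(\<Sum>j = 2..2 * n + 1. (- 1) ^ j * (c j + c (j + 1))) = c 2 - c (2 * n + 2)"
proof (induction n)
  case (Suc n)
  \<comment> \<open>Two summands of opposite sign are added per step; their common
    \<open>c (2 * n + 3)\<close> cancels.\<close>
  have "{2..2 * Suc n + 1} = insert (2 * n + 2) (insert (2 * n + 3) {2..2 * n + 1})"
    by auto
  then have "(\<Sum>j = 2..2 * Suc n + 1. (- 1) ^ j * (c j + c (j + 1))) =
      (\<Sum>j = 2..2 * n + 1. (- 1) ^ j * (c j + c (j + 1))) +
      (c (2 * n + 2) + c (2 * n + 3)) - (c (2 * n + 3) + c (2 * n + 4))"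
    by (simp add: numeral_eq_Suc) (simp flip: mult_2)
  then show ?case
    unfolding Suc.IH by (simp add: numeral_eq_Suc)
qed (simp add: numeral_2_eq_2)

section \<open>Row expansion of the cyclic product\<close>

text \<open>The factor closing the cycle is \<open>w\<close> while both ends of the path remain.
  Without an end it is \<open>w\<close> plus the factor missing from the gap product, and that
  factor times the gap product is \<open>P\<close>.\<close>

lemma cyclic_prod_skip:
  fixes x :: "nat \<Rightarrow> 'r::comm_ring_1"
  assumes "n \<ge> 1"
  defines "w \<equiv> x (2 * n + 2) - x 2"
    and "P \<equiv> \<Prod>i = 2..2 * n + 1. x i - x (i + 1)"
    and "Q \<equiv> gap_prod x (2 * n + 1)"
    and "T \<equiv> \<lambda>j. cyclic_prod (2 * n) (\<lambda>p. x (skip j p))"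
  shows "T 2 = Q 2 * w + P"
    and "T (2 * n + 2) = Q (2 * n + 1) * w + P"
    and "3 \<le> j \<Longrightarrow> j \<le> 2 * n + 1 \<Longrightarrow> T j = (Q j + Q (j - 1)) * w"
proof -
  have T: "T j = (\<Prod>i = 1..2 * n - 1. x (skip j i) - x (skip j (i + 1))) *
      (x (skip j (2 * n)) - x (skip j 1))" for j
    by (simp add: T_def cyclic_prod_def)
  have n1: "2 * n - 1 + 2 = 2 * n + 1" "2 * n - 1 + 3 = 2 * n + 2"
    using assms(1) by auto
  have "skip 2 (2 * n) = 2 * n + 2" "skip 2 1 = 3"
    using assms(1) by (auto simp: skip_def)
  then have T2: "T 2 = Q 2 * (x (2 * n + 2) - x 3)"
    using path_prod_skip_first[of x "2 * n - 1"] unfolding T Q_def n1 by simp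
  have P2: "P = (x 2 - x 3) * Q 2"
    unfolding P_def Q_def using assms(1) gap_prod_remove[of 2 "2 * n + 1" x] by simp
  show "T 2 = Q 2 * w + P"
    unfolding T2 P2 w_def by (simp add: algebra_simps)
  have "skip (2 * n + 2) (2 * n) = 2 * n + 1" "skip (2 * n + 2) 1 = 2"
    using assms(1) by (auto simp: skip_def)
  then have Tl: "T (2 * n + 2) = Q (2 * n + 1) * (x (2 * n + 1) - x 2)"
    using path_prod_skip_last[of x "2 * n - 1"] unfolding T Q_def n1 by simp
  have Pl: "P = (x (2 * n + 1) - x (2 * n + 2)) * Q (2 * n + 1)"
    unfolding P_def Q_def using assms(1) gap_prod_remove[of "2 * n + 1" "2 * n + 1" x] by simp
  show "T (2 * n + 2) = Q (2 * n + 1) * w + P"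
    unfolding Tl Pl w_def by (simp add: algebra_simps)
  show "T j = (Q j + Q (j - 1)) * w" if "3 \<le> j" "j \<le> 2 * n + 1"
  proof -
    have "skip j (2 * n) = 2 * n + 2" "skip j 1 = 2"
      using that by (auto simp: skip_def)
    then show ?thesis
      using path_prod_skip_interior[of j "2 * n - 1" x] that unfolding T Q_def w_def n1 by simp
  qed
qed

lemma sum_cyclic_prod_skip:
  fixes x :: "nat \<Rightarrow> 'r::comm_ring_1"
  assumes "n \<ge> 1"
  shows "(\<Sum>j = 2..2 * n + 2. (- 1) ^ j * (x 1 - x j)\<^sup>2 * cyclic_prod (2 * n) (\<lambda>p. x (skip j p))) =
    - 2 * cyclic_prod (2 * n + 2) x"
proof -
  define w P Q T f where "w = x (2 * n + 2) - x 2"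
    and "P = (\<Prod>i = 2..2 * n + 1. x i - x (i + 1))"
    and "Q = gap_prod x (2 * n + 1)"
    and "T = (\<lambda>j. cyclic_prod (2 * n) (\<lambda>p. x (skip j p)))"
    and "f = (\<lambda>j. (x 1 - x j)\<^sup>2)"
  have T: "T 2 = Q 2 * w + P" "T (2 * n + 2) = Q (2 * n + 1) * w + P"
    "\<And>j. 3 \<le> j \<Longrightarrow> j \<le> 2 * n + 1 \<Longrightarrow> T j = (Q j + Q (j - 1)) * w"
    unfolding w_def P_def Q_def T_def using cyclic_prod_skip[OF assms, where x = x] by blast+
  have "(\<Sum>j = 2..2 * n + 2. (- 1) ^ j * f j * T j) =
      f 2 * T 2 + (\<Sum>j = 3..2 * n + 1. (- 1) ^ j * f j * T j) + f (2 * n + 2) * T (2 * n + 2)"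
  proof -
    have "{2..2 * n + 2} = insert 2 (insert (2 * n + 2) {3..2 * n + 1})"
      using assms by auto
    then show ?thesis
      using assms by simp
  qed
  also have "(\<Sum>j = 3..2 * n + 1. (- 1) ^ j * f j * T j) =
      (\<Sum>j = 3..2 * n + 1. (- 1) ^ j * f j * (Q j + Q (j - 1))) * w"
    unfolding sum_distrib_right by (intro sum.cong refl) (use T(3) in \<open>auto simp: mult.assoc\<close>)
  \<comment> \<open>The \<open>Q\<close> parts of the end terms complete the summation by parts for
    \<open>m = 2 * n + 1\<close>; their \<open>P\<close> parts are split off.\<close>
  also have "f 2 * T 2 + \<dots> + f (2 * n + 2) * T (2 * n + 2) =
      (f 2 * Q 2 + (\<Sum>j = 3..2 * n + 1. (- 1) ^ j * f j * (Q j + Q (j - 1))) +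
        (- 1) ^ (2 * n + 1 + 1) * f (2 * n + 1 + 1) * Q (2 * n + 1)) * w + P * (f 2 + f (2 * n + 2))"
    unfolding T(1,2) by (simp add: algebra_simps)
  also have "\<dots> = (\<Sum>j = 2..2 * n + 1. (- 1) ^ j * (Q j * (f j - f (j + 1)))) * w +
      P * (f 2 + f (2 * n + 2))"
    by (subst alternating_sum_by_parts) (use assms in auto)
  \<comment> \<open>The difference of squares \<open>f j - f (j + 1)\<close> contains the factor
    missing from \<open>Q j\<close>, so every summand acquires the same \<open>P\<close>.\<close>
  also have "(\<Sum>j = 2..2 * n + 1. (- 1) ^ j * (Q j * (f j - f (j + 1)))) =
      P * (\<Sum>j = 2..2 * n + 1. (- 1) ^ j * ((x j - x 1) + (x (j + 1) - x 1)))"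
    unfolding sum_distrib_left
  proof (rule sum.cong[OF refl])
    fix j assume j: "j \<in> {2..2 * n + 1}"
    have P: "P = (x j - x (j + 1)) * Q j"
      unfolding P_def Q_def using j by (intro gap_prod_remove) auto
    show "(- 1) ^ j * (Q j * (f j - f (j + 1))) =
        P * ((- 1) ^ j * ((x j - x 1) + (x (j + 1) - x 1)))"
      unfolding P by (simp add: f_def power2_eq_square algebra_simps)
  qed
  also have "\<dots> = - (P * w)"
    unfolding alternating_telescope[of "\<lambda>j. x j - x 1"] by (simp add: w_def algebra_simps)
  \<comment> \<open>Here \<open>w = (x 1 - x 2) + (x (2 * n + 2) - x 1)\<close>, so only the mixed
    term of its square survives.\<close>
  also have "- (P * w) * w + P * (f 2 + f (2 * n + 2)) =
      - 2 * ((x 1 - x 2) * P * (x (2 * n + 2) - x 1))"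
    by (simp add: w_def f_def power2_eq_square algebra_simps)
  also have "(x 1 - x 2) * P * (x (2 * n + 2) - x 1) = cyclic_prod (2 * n + 2) x"
  proof -
    have "{1..2 * n + 2 - 1} = insert 1 {2..2 * n + 1}"
      by auto
    then show ?thesis
      unfolding cyclic_prod_def P_def by (simp add: numeral_2_eq_2)
  qed
  finally show ?thesis
    unfolding f_def T_def .
qed

text \<open>The induction needs arbitrary \<open>x\<close>: the row expansion applies the hypothesis
  to each sequence \<open>\<lambda>p. x (skip j p)\<close>. Each step contributes one factor
  \<open>- 2\<close>.\<close>

theorem pfaffian_squared_differences:
  fixes x :: "nat \<Rightarrow> 'r::comm_ring_1"
  assumes "n \<ge> 1"
  shows "pfaffian n (\<lambda>i j. (x i - x j)\<^sup>2) = - ((- 2) ^ (n - 1) * cyclic_prod (2 * n) x)"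
  using assms
proof (induction n arbitrary: x rule: dec_induct)
  case base
  have "pfaffian (Suc 0) (\<lambda>i j. (x i - x j)\<^sup>2) = (x 1 - x 2)\<^sup>2"
    by (simp add: pfaffian_Suc pfaffian_0 numeral_2_eq_2)
  then show ?case
    by (simp add: cyclic_prod_def power2_eq_square algebra_simps numeral_2_eq_2)
next
  case (step n)
  have "pfaffian (Suc n) (\<lambda>i j. (x i - x j)\<^sup>2) =
      - ((- 2) ^ (n - 1)) * (\<Sum>j = 2..2 * n + 2. (- 1) ^ j * (x 1 - x j)\<^sup>2 *
        cyclic_prod (2 * n) (\<lambda>p. x (skip j p)))"
    unfolding pfaffian_Suc step.IH sum_distrib_left
    by (intro sum.cong refl) (simp add: algebra_simps)
  also have "\<dots> = - ((- 2) ^ Suc (n - 1) * cyclic_prod (2 * Suc n) x)"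
    unfolding sum_cyclic_prod_skip[OF step(1)] by (simp add: mult.assoc mult.left_commute)
  finally show ?case
    using step(1) by simp
qed

theorem theorem1p3:
  fixes x :: "nat \<Rightarrow> 'a::field mpoly" and n :: nat
  defines "x \<equiv> indet"
  assumes "CHAR('a) \<noteq> 2"
    and "n \<ge> 1"
  shows "pfaffian n (\<lambda>i j. (x i - x j)^2) =
    - ((- 2) ^ (n - 1) * ((\<Prod>i = 1..2 * n - 1. x i - x (i + 1)) * (x (2 * n) - x 1)))"
  using pfaffian_squared_differences[OF assms(3), of x] by (simp only: cyclic_prod_def)

end
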